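(* Let $(\mathcal G,\mathfrak g_1,\mathfrak g_2)$ be a twilled 3-Lie algebra with bracket $\Omega$ and let $H:\mathfrak g_2\to\mathfrak g_1$ be a linear map. Then the twisting $((\mathcal G,\Omega^H),\mathfrak g_1,\mathfrak g_2)$ is also a twilled 3-Lie algebra if and only if $H$ is a Maurer–Cartan element of the $L_\infty$-algebra $\left(\bigoplus_{m\ge0}C^m(\mathfrak g_2,\mathfrak g_1),l_1,l_2,l_3\right)$ associated with the twilled 3-Lie algebra $(\mathcal G,\mathfrak g_1,\mathfrak g_2)$.
   Context: All vector spaces are finite-dimensional over an algebraically closed field of characteristic $0$. **3-Lie algebra.** A vector space with a skew-symmetric trilinear bracket satisfying $[x_1,x_2,[x_3,x_4,x_5]]=[[x_1,x_2,x_3],x_4,x_5]+[x_3,[x_1,x_2,x_4],x_5]+[x_3,x_4,[x_1,x_2,x_5]]$. **Cochains.** For vector spaces $V,W$, $C^0(V,W)=\mathrm{Hom}(V,W)$ and for $n\ge1$, $C^n(V,W)=\mathrm{Hom}(\underbrace{\wedge^2V\otimes\cdots\otimes\wedge^2V}_{n}\wedge V,W)$ consists of the maps $f(\mathfrak X_1,\dots,\mathfrak X_n,x)$, multilinear in $\mathfrak X_i\in\wedge^2V$, $x\in V$, which for $\mathfrak X_n=x_n\wedge y_n$ are skew-symmetric in $x_n,y_n,x$. **Graded bracket.** For $P\in C^p(V,V)$, $Q\in C^q(V,V)$, $\mathfrak X_i=x_i\wedge y_i$: $$\begin{aligned}(P\circ Q)&(\mathfrak X_1,\dots,\mathfrak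 X_{p+q},x)\\=&\sum_{k=1}^p(-1)^{(k-1)q}\sum_{\sigma\in S(k-1,q)}(-1)^\sigma P(\mathfrak X_{\sigma(1)},\dots,\mathfrak X_{\sigma(k-1)},Q(\mathfrak X_{\sigma(k)},\dots,\mathfrak X_{\sigma(k+q-1)},x_{k+q})\wedge y_{k+q},\mathfrak X_{k+q+1},\dots,\mathfrak X_{p+q},x)\\&+\sum_{k=1}^p(-1)^{(k-1)q}\sum_{\sigma\in S(k-1,q)}(-1)^\sigma P(\mathfrak X_{\sigma(1)},\dots,\mathfrak X_{\sigma(k-1)},x_{k+q}\wedge Q(\mathfrak X_{\sigma(k)},\dots,\mathfrak X_{\sigma(k+q-1)},y_{k+q}),\mathfrak X_{k+q+1},\dots,\mathfrak X_{p+q},x)\\&+\sum_{\sigma\in S(p,q)}(-1)^{pq}(-1)^\sigma P(\mathfrak X_{\sigma(1)},\dots,\mathfrak X_{\sigma(p)},Q(\mathfrak X_{\sigma(p+1)},\dots,\mathfrak X_{\sigma(p+q)},x)),\end{aligned}$$ $S(i,j)$ being the $(i,j)$-shuffles of $\{1,\dots,i+j\}$, and $[P,Q]=P\circ Q-(-1)^{pq}Q\circ P$ (a graded Lie bracket on $\bigoplus_nC^n(V,V)$). In particular for $\Theta\in C^1(V,V)=\mathrm{Hom}(\wedge^3V,V)$ and $A\in C^0(V,V)$: $[\Theta,A](a,b,c)=\Theta(Aa,b,c)+\Theta(a,Ab,c)+\Theta(a,b,Ac)-A\Theta(a,b,c)$. **Twilled 3-Lie algebra.** A 3-Lie algebra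 $(\mathcal G,\Omega=[\cdot,\cdot,\cdot]_{\mathcal G})$ with vector space decomposition $\mathcal G=\mathfrak g_1\oplus\mathfrak g_2$ into two subalgebras. Write $[\alpha,\beta,\gamma]_i$ for the $\mathfrak g_i$-component of $[\alpha,\beta,\gamma]_{\mathcal G}$. For $x,y,z\in\mathfrak g_1$, $u,v,w\in\mathfrak g_2$, $\Omega=\hat\mu_1+\hat\psi+\hat\mu_2$ with $\hat\mu_1((x,u),(y,v),(z,w))=([x,y,z]_1,[x,y,w]_2+[u,y,z]_2+[x,v,z]_2)$, $\hat\psi((x,u),(y,v),(z,w))=([x,y,w]_1+[u,y,z]_1+[x,v,z]_1,[x,v,w]_2+[u,y,w]_2+[u,v,z]_2)$, $\hat\mu_2((x,u),(y,v),(z,w))=([x,v,w]_1+[u,y,w]_1+[u,v,z]_1,[u,v,w]_2)$. **Lift.** The lift $\hat g\in C^m(\mathcal G,\mathcal G)$ of $g\in C^m(\mathfrak g_2,\mathfrak g_1)$ is obtained by projecting all arguments to $\mathfrak g_2$, applying $g$, and including $\mathfrak g_1\subset\mathcal G$; for $H:\mathfrak g_2\to\mathfrak g_1$, $\hat H(x,u)=(H(u),0)$. **Twisting.** $\Omega^H:=e^{[\cdot,\hat H]}\Omega=\sum_{i\ge0}\frac1{i!}([\cdot,\hat H])^i\Omega$ (the sum is finite). **Associated $L_\infty$-algebra.** $\bigoplus_{m\ge0}C^m(\mathfrak g_2,\mathfrak g_1)$, with $C^m$ in degree $m$, elements identified with their lifts, and operations $l_1(g_1)=[\hat\mu_2,\hat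 g_1]$, $l_2(g_1,g_2)=[[\hat\psi,\hat g_1],\hat g_2]$, $l_3(g_1,g_2,g_3)=[[[\hat\mu_1,\hat g_1],\hat g_2],\hat g_3]$, $l_k=0$ for $k\ge4$. A Maurer–Cartan element is a degree-$0$ element $\alpha$ with $\sum_{k\ge1}\frac1{k!}l_k(\alpha,\dots,\alpha)=0$; for $H$ it reads $l_1(H)+\frac12l_2(H,H)+\frac16l_3(H,H,H)=0$. *)

theory Defs
  imports
    "HOL-Computational_Algebra.Polynomial"
    "HOL-Combinatorics.Permutations"
    "HOL-Library.Groups_Big_Fun"
begin

section \<open>3-Lie algebras and twilled 3-Lie algebras\<close>

locale three_Lie_algebra = vector_space scale
  for scale :: "'k::field \<Rightarrow> 'g::ab_group_add \<Rightarrow> 'g" +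
  fixes br :: "'g \<Rightarrow> 'g \<Rightarrow> 'g \<Rightarrow> 'g"
  assumes linear_1: "Vector_Spaces.linear scale scale (\<lambda>x. br x y z)"
    and linear_2: "Vector_Spaces.linear scale scale (\<lambda>y. br x y z)"
    and linear_3: "Vector_Spaces.linear scale scale (\<lambda>z. br x y z)"
    and skew_12: "br y x z = - br x y z"
    and skew_23: "br x z y = - br x y z"
    and fundamental_identity:
      "br x1 x2 (br x3 x4 x5) =
         br (br x1 x2 x3) x4 x5 + br x3 (br x1 x2 x4) x5 + br x3 x4 (br x1 x2 x5)"

locale twilled_three_Lie_algebra = three_Lie_algebra scale br
  for scale :: "'k::field \<Rightarrow> 'g::ab_group_add \<Rightarrow> 'g" and br +
  fixes g1 g2 :: "'g set"
  assumes subspace_1: "subspace g1"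
    and subspace_2: "subspace g2"
    and sum_UNIV: "\<exists>x\<in>g1. \<exists>u\<in>g2. a = x + u"
    and Int_zero: "g1 \<inter> g2 = {0}"
    and closed_1: "\<lbrakk>x \<in> g1; y \<in> g1; z \<in> g1\<rbrakk> \<Longrightarrow> br x y z \<in> g1"
    and closed_2: "\<lbrakk>u \<in> g2; v \<in> g2; w \<in> g2\<rbrakk> \<Longrightarrow> br u v w \<in> g2"

text \<open>The component in \<open>V\<close> of a vector of \<open>V \<oplus> W\<close>; the component in \<open>W\<close> is \<open>proj W V\<close>.\<close>

definition proj :: "'g::ab_group_add set \<Rightarrow> 'g set \<Rightarrow> 'g \<Rightarrow> 'g" where
  "proj V W a = (THE x. x \<in> V \<and> (\<exists>u\<in>W. a = x + u))"


section \<open>Cochains\<close>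

text \<open>
  A map \<open>f(X_1, ..., X_n, x)\<close> that is multilinear in \<open>X_i\<close> in the second exterior power is given by
  its values on decomposable arguments \<open>X_i = x_i \<and> y_i\<close>, that is, by a map that is bilinear and
  skew-symmetric in each pair \<open>(x_i, y_i)\<close>. The list of these pairs is the first argument of a
  cochain. An element of \<open>C^n(V,W)\<close> is extended by zero to lists of length other than \<open>n\<close> and to
  vectors outside \<open>V\<close>. Consequently a function on lists of arbitrary length also represents an
  element of the direct sum of the \<open>C^n(V,W)\<close>: its component of degree \<open>n\<close> is its restriction to
  lists of length \<open>n\<close>.
\<close>

type_synonym 'g cochain = "('g \<times> 'g) list \<Rightarrow> 'g \<Rightarrow> 'g"

definition linear_on ::
  "('k \<Rightarrow> 'g::ab_group_add \<Rightarrow> 'g) \<Rightarrow> 'g set \<Rightarrow> 'g set \<Rightarrow> ('g \<Rightarrow> 'g) \<Rightarrow> bool" where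
  "linear_on scale V W f \<longleftrightarrow>
     (\<forall>x\<in>V. f x \<in> W) \<and>
     (\<forall>x\<in>V. \<forall>y\<in>V. f (x + y) = f x + f y) \<and>
     (\<forall>c. \<forall>x\<in>V. f (scale c x) = scale c (f x))"

definition cochains ::
  "('k \<Rightarrow> 'g::ab_group_add \<Rightarrow> 'g) \<Rightarrow> 'g set \<Rightarrow> 'g set \<Rightarrow> nat \<Rightarrow> 'g cochain set" where
  "cochains scale V W n = {f.
     (\<forall>Xs x. \<not> (length Xs = n \<and> set Xs \<subseteq> V \<times> V \<and> x \<in> V) \<longrightarrow> f Xs x = 0) \<and>
     (\<forall>Xs. length Xs = n \<and> set Xs \<subseteq> V \<times> V \<longrightarrow>
        linear_on scale V W (f Xs) \<and>
        (\<forall>i<n. \<forall>x\<in>V. \<forall>a\<in>V. \<forall>b\<in>V.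
           linear_on scale V W (\<lambda>a. f (Xs[i := (a, b)]) x) \<and>
           linear_on scale V W (\<lambda>b. f (Xs[i := (a, b)]) x) \<and>
           f (Xs[i := (b, a)]) x = - f (Xs[i := (a, b)]) x) \<and>
        (n \<ge> 1 \<longrightarrow> (\<forall>x\<in>V. \<forall>a\<in>V. \<forall>b\<in>V.
           f (Xs[n - 1 := (a, x)]) b = - f (Xs[n - 1 := (a, b)]) x)))}"

definition cochain0 :: "'g::zero set \<Rightarrow> ('g \<Rightarrow> 'g) \<Rightarrow> 'g cochain" where
  "cochain0 V f = (\<lambda>Xs x. if Xs = [] \<and> x \<in> V then f x else 0)"

definition cochain1 :: "('g::zero \<Rightarrow> 'g \<Rightarrow> 'g \<Rightarrow> 'g) \<Rightarrow> 'g cochain" where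
  "cochain1 \<theta> = (\<lambda>Xs z. case Xs of [(x, y)] \<Rightarrow> \<theta> x y z | _ \<Rightarrow> 0)"

definition lift :: "'g::ab_group_add set \<Rightarrow> 'g set \<Rightarrow> 'g cochain \<Rightarrow> 'g cochain" where
  "lift g1 g2 f =
     (\<lambda>Xs x. f (map (map_prod (proj g2 g1) (proj g2 g1)) Xs) (proj g2 g1 x))"


section \<open>The graded bracket\<close>

definition shuffle_perms :: "nat \<Rightarrow> nat \<Rightarrow> (nat \<Rightarrow> nat) set" where
  "shuffle_perms i j =
     {\<sigma>. \<sigma> permutes {1..i+j} \<and> strict_mono_on {1..i} \<sigma> \<and> strict_mono_on {i+1..i+j} \<sigma>}"

text \<open>
  \<open>circ p q P Q\<close> is \<open>P \<circ> Q\<close> for the degree \<open>p\<close> component of \<open>P\<close> and the degree \<open>q\<close> component of \<open>Q\<close>,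
  evaluated at lists of length \<open>p + q\<close>; the local \<open>X\<close> numbers the entries of the list from 1.
\<close>

definition circ ::
  "('k::field \<Rightarrow> 'g::ab_group_add \<Rightarrow> 'g) \<Rightarrow> nat \<Rightarrow> nat \<Rightarrow> 'g cochain \<Rightarrow> 'g cochain \<Rightarrow> 'g cochain" where
  "circ scale p q P Q Xs x =
     (let X = (\<lambda>i. Xs ! (i - 1)) in
       (\<Sum>k=1..p. scale ((-1) ^ ((k - 1) * q)) (\<Sum>\<sigma>\<in>shuffle_perms (k - 1) q. scale (of_int (sign \<sigma>))
          (P (map (X \<circ> \<sigma>) [1..<k]
              @ [(Q (map (X \<circ> \<sigma>) [k..<k+q]) (fst (X (k+q))), snd (X (k+q)))]
              @ map X [k+q+1..<p+q+1]) x)))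
     + (\<Sum>k=1..p. scale ((-1) ^ ((k - 1) * q)) (\<Sum>\<sigma>\<in>shuffle_perms (k - 1) q. scale (of_int (sign \<sigma>))
          (P (map (X \<circ> \<sigma>) [1..<k]
              @ [(fst (X (k+q)), Q (map (X \<circ> \<sigma>) [k..<k+q]) (snd (X (k+q))))]
              @ map X [k+q+1..<p+q+1]) x)))
     + (\<Sum>\<sigma>\<in>shuffle_perms p q. scale ((-1) ^ (p * q)) (scale (of_int (sign \<sigma>))
          (P (map (X \<circ> \<sigma>) [1..<p+1]) (Q (map (X \<circ> \<sigma>) [p+1..<p+q+1]) x)))))"

text \<open>
  The bracket on the direct sum of all \<open>C^n(V,V)\<close>: the degree \<open>n\<close> component of \<open>[P,Q]\<close> is the sum
  over \<open>p + q = n\<close> of the brackets of the components \<open>P_p\<close> and \<open>Q_q\<close>.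
\<close>

definition gbracket ::
  "('k::field \<Rightarrow> 'g::ab_group_add \<Rightarrow> 'g) \<Rightarrow> 'g cochain \<Rightarrow> 'g cochain \<Rightarrow> 'g cochain" where
  "gbracket scale P Q Xs x =
     (\<Sum>(p, q) \<in> {(p, q). p + q = length Xs}.
        circ scale p q P Q Xs x - scale ((-1) ^ (p * q)) (circ scale q p Q P Xs x))"


section \<open>Twisting\<close>

text \<open>
  \<open>Sum_any\<close> is the sum over the support of its argument, as only finitely many terms of the
  exponential series are nonzero.
\<close>

definition twist ::
  "('k::field_char_0 \<Rightarrow> 'g::ab_group_add \<Rightarrow> 'g) \<Rightarrow> ('g \<Rightarrow> 'g \<Rightarrow> 'g \<Rightarrow> 'g) \<Rightarrow> 'g cochain
     \<Rightarrow> 'g \<Rightarrow> 'g \<Rightarrow> 'g \<Rightarrow> 'g" where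
  "twist scale \<Omega> A x y z =
     Sum_any (\<lambda>i. scale (1 / fact i)
       (((\<lambda>P. gbracket scale P A) ^^ i) (cochain1 \<Omega>) [(x, y)] z))"


section \<open>The associated \<open>L\<^sub>\<infinity>\<close>-algebra\<close>

definition mu1_hat ::
  "('g::ab_group_add \<Rightarrow> 'g \<Rightarrow> 'g \<Rightarrow> 'g) \<Rightarrow> 'g set \<Rightarrow> 'g set \<Rightarrow> 'g \<Rightarrow> 'g \<Rightarrow> 'g \<Rightarrow> 'g" where
  "mu1_hat \<Omega> g1 g2 a b c =
     (let p1 = proj g1 g2; p2 = proj g2 g1;
          x = p1 a; u = p2 a; y = p1 b; v = p2 b; z = p1 c; w = p2 c
      in p1 (\<Omega> x y z) + (p2 (\<Omega> x y w) + p2 (\<Omega> u y z) + p2 (\<Omega> x v z)))"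

definition psi_hat ::
  "('g::ab_group_add \<Rightarrow> 'g \<Rightarrow> 'g \<Rightarrow> 'g) \<Rightarrow> 'g set \<Rightarrow> 'g set \<Rightarrow> 'g \<Rightarrow> 'g \<Rightarrow> 'g \<Rightarrow> 'g" where
  "psi_hat \<Omega> g1 g2 a b c =
     (let p1 = proj g1 g2; p2 = proj g2 g1;
          x = p1 a; u = p2 a; y = p1 b; v = p2 b; z = p1 c; w = p2 c
      in (p1 (\<Omega> x y w) + p1 (\<Omega> u y z) + p1 (\<Omega> x v z))
       + (p2 (\<Omega> x v w) + p2 (\<Omega> u y w) + p2 (\<Omega> u v z)))"

definition mu2_hat ::
  "('g::ab_group_add \<Rightarrow> 'g \<Rightarrow> 'g \<Rightarrow> 'g) \<Rightarrow> 'g set \<Rightarrow> 'g set \<Rightarrow> 'g \<Rightarrow> 'g \<Rightarrow> 'g \<Rightarrow> 'g" where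
  "mu2_hat \<Omega> g1 g2 a b c =
     (let p1 = proj g1 g2; p2 = proj g2 g1;
          x = p1 a; u = p2 a; y = p1 b; v = p2 b; z = p1 c; w = p2 c
      in (p1 (\<Omega> x v w) + p1 (\<Omega> u y w) + p1 (\<Omega> u v z)) + p2 (\<Omega> u v w))"

text \<open>
  Cochains in \<open>C^m(g2,g1)\<close> are identified with their lifts, so the graded vector space underlying
  the \<open>L\<^sub>\<infinity>\<close>-algebra consists of lifts. The list of arguments of \<open>Linf_op\<close> determines the arity.
\<close>

definition Linf_space ::
  "('k \<Rightarrow> 'g::ab_group_add \<Rightarrow> 'g) \<Rightarrow> 'g set \<Rightarrow> 'g set \<Rightarrow> nat \<Rightarrow> 'g cochain set" where
  "Linf_space scale g1 g2 m = lift g1 g2 ` cochains scale g2 g1 m"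

definition Linf_op ::
  "('k::field \<Rightarrow> 'g::ab_group_add \<Rightarrow> 'g) \<Rightarrow> ('g \<Rightarrow> 'g \<Rightarrow> 'g \<Rightarrow> 'g) \<Rightarrow> 'g set \<Rightarrow> 'g set
     \<Rightarrow> 'g cochain list \<Rightarrow> 'g cochain" where
  "Linf_op scale \<Omega> g1 g2 fs =
     (case fs of
        [f1] \<Rightarrow> gbracket scale (cochain1 (mu2_hat \<Omega> g1 g2)) f1
      | [f1, f2] \<Rightarrow> gbracket scale (gbracket scale (cochain1 (psi_hat \<Omega> g1 g2)) f1) f2
      | [f1, f2, f3] \<Rightarrow>
          gbracket scale (gbracket scale (gbracket scale (cochain1 (mu1_hat \<Omega> g1 g2)) f1) f2) f3
      | _ \<Rightarrow> (\<lambda>Xs x. 0))"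

definition Maurer_Cartan ::
  "('k::field_char_0 \<Rightarrow> 'g::ab_group_add \<Rightarrow> 'g) \<Rightarrow> (nat \<Rightarrow> 'g cochain set)
     \<Rightarrow> ('g cochain list \<Rightarrow> 'g cochain) \<Rightarrow> 'g cochain \<Rightarrow> bool" where
  "Maurer_Cartan scale E l \<alpha> \<longleftrightarrow>
     \<alpha> \<in> E 0 \<and>
     (\<forall>Xs x. Sum_any (\<lambda>k. if k \<ge> 1 then scale (1 / fact k) (l (replicate k \<alpha>) Xs x) else 0) = 0)"

end

theory Submission
  imports Defs
begin

text \<open>
  Write \<open>N\<close> for the extension of \<open>H\<close> by zero on \<open>g1\<close>. It takes values in \<open>g1\<close>, where it vanishes,
  so \<open>N\<^sup>2 = 0\<close> and \<open>exp N = 1 + N\<close> has inverse \<open>1 - N\<close>. Bracketing with \<open>N\<close> is the derivation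
  that inserts \<open>N\<close> into each argument and subtracts \<open>N\<close> applied to the result, so its exponential
  is conjugation by \<open>exp N\<close> (\<open>twist_conjugation\<close>):
  \<open>\<Omega>\<^sup>H(a,b,c) = (1 - N) \<Omega>((1 + N)a, (1 + N)b, (1 + N)c)\<close>.
  The divided powers of the derivation are given by \<open>ad_term\<close>: since \<open>N\<^sup>2 = 0\<close>, the \<open>i\<close>-th one
  consists of all insertions of \<open>N\<close> into \<open>i\<close> different arguments, minus \<open>N\<close> applied to the
  insertions into \<open>i - 1\<close> arguments.

  The conjugate of a 3-Lie bracket is again a 3-Lie bracket, and \<open>g1\<close> remains a subalgebra because
  \<open>N\<close> vanishes on it. So the twisted structure is twilled if and only if \<open>g2\<close> is closed under
  \<open>\<Omega>\<^sup>H\<close>, that is, if and only if the \<open>g1\<close>-component of \<open>\<Omega>\<^sup>H(u,v,w)\<close> is zero for all \<open>u\<close>, \<open>v\<close>,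
  \<open>w\<close> in \<open>g2\<close>. Sorting this component by the number of occurrences of \<open>H\<close> gives exactly the three
  summands of the Maurer-Cartan expression (\<open>Maurer_Cartan_expression\<close>): the linear part only
  sees \<open>\<mu>\<^sub>2\<close>, the quadratic part \<open>\<psi>\<close> and the cubic part \<open>\<mu>\<^sub>1\<close>. The parts with zero and four
  occurrences vanish because \<open>g2\<close> and \<open>g1\<close> are subalgebras for \<open>\<Omega>\<close>.
\<close>

section \<open>The graded bracket of homogeneous cochains\<close>

text \<open>
  Multilinearity enters the degree count only through the vanishing at zero arguments.
\<close>

definition homogeneous :: "nat \<Rightarrow> 'g::ab_group_add cochain \<Rightarrow> bool" where
  "homogeneous n P \<longleftrightarrow>
     (\<forall>Xs x. length Xs \<noteq> n \<longrightarrow> P Xs x = 0) \<and>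
     (\<forall>Xs. P Xs 0 = 0) \<and>
     (\<forall>Xs Ys y x. P (Xs @ [(0, y)] @ Ys) x = 0 \<and> P (Xs @ [(y, 0)] @ Ys) x = 0)"

definition zero_absorbing :: "('g::ab_group_add \<Rightarrow> 'g \<Rightarrow> 'g \<Rightarrow> 'g) \<Rightarrow> bool" where
  "zero_absorbing \<theta> \<longleftrightarrow> (\<forall>y z. \<theta> 0 y z = 0 \<and> \<theta> y 0 z = 0 \<and> \<theta> y z 0 = 0)"

lemma zero_absorbingD:
  assumes "zero_absorbing \<theta>"
  shows "\<theta> 0 y z = 0" "\<theta> y 0 z = 0" "\<theta> y z 0 = 0"
  using assms by (auto simp: zero_absorbing_def)

lemma homogeneous_cochain0: "N 0 = 0 \<Longrightarrow> homogeneous 0 (cochain0 UNIV N)"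
  by (auto simp: homogeneous_def cochain0_def)

lemma homogeneous_cochain1: "zero_absorbing \<theta> \<Longrightarrow> homogeneous 1 (cochain1 \<theta>)"
  by (auto simp: homogeneous_def cochain1_def zero_absorbing_def append_eq_Cons_conv
      split: list.splits)

lemma shuffle_perms_trivial:
  "shuffle_perms 0 0 = {id}" "shuffle_perms 0 (Suc 0) = {id}" "shuffle_perms (Suc 0) 0 = {id}"
proof -
  have "\<sigma> permutes {Suc 0..Suc 0} \<Longrightarrow> \<sigma> = id" for \<sigma>
    by (simp add: permutes_sing)
  then show "shuffle_perms 0 0 = {id}" "shuffle_perms 0 (Suc 0) = {id}"
    "shuffle_perms (Suc 0) 0 = {id}"
    by (auto simp: shuffle_perms_def permutes_id strict_mono_on_def)
qed

context vector_space
begin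

text \<open>
  If the degree of \<open>P\<close> is wrong, every term applies \<open>P\<close> to a list of the wrong length. If only the
  degree of \<open>Q\<close> is wrong, the value of \<open>Q\<close> is zero and \<open>P\<close> is evaluated at a zero argument.
\<close>

lemma circ_degree_mismatch:
  assumes P: "homogeneous p0 P" and Q: "homogeneous q0 Q" and ne: "p \<noteq> p0 \<or> q \<noteq> q0"
  shows "circ scale p q P Q Xs x = 0"
proof -
  have P_len: "P Ys y = 0" if "length Ys \<noteq> p0" for Ys y
    using P that by (auto simp: homogeneous_def)
  have Q_len: "Q Ys y = 0" if "length Ys \<noteq> q0" for Ys y
    using Q that by (auto simp: homogeneous_def)
  have P_zero: "P Ys 0 = 0" "P (Ys @ (0, y) # Zs) z = 0" "P (Ys @ (y, 0) # Zs) z = 0" for Ys Zs y z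
    using P by (auto simp: homogeneous_def)
  show ?thesis
  proof (cases "p = p0")
    case True
    then have "q \<noteq> q0" using ne by simp
    then show ?thesis
      by (simp add: circ_def Let_def Q_len P_zero)
  next
    case False
    then show ?thesis
      by (simp add: circ_def Let_def P_len)
  qed
qed

lemma gbracket_homogeneous:
  assumes P: "homogeneous p P" and Q: "homogeneous q Q"
  shows "gbracket scale P Q Xs x =
    (if length Xs = p + q
     then circ scale p q P Q Xs x - scale ((-1) ^ (p * q)) (circ scale q p Q P Xs x) else 0)"
proof -
  let ?S = "{(i, j). i + j = length Xs}"
  let ?f = "\<lambda>(i, j). circ scale i j P Q Xs x - scale ((-1) ^ (i * j)) (circ scale j i Q P Xs x)"
  have zero: "?f (i, j) = 0" if "(i, j) \<noteq> (p, q)" for i j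
    using that circ_degree_mismatch[OF P Q, of i j Xs x] circ_degree_mismatch[OF Q P, of j i Xs x]
    by auto
  have fin: "finite ?S"
    by (rule finite_subset[of _ "{..length Xs} \<times> {..length Xs}"]) auto
  have "gbracket scale P Q Xs x = sum ?f ?S"
    by (simp add: gbracket_def)
  also have "\<dots> = sum ?f (?S \<inter> {(p, q)})"
  proof (rule sum.mono_neutral_right[OF fin])
    show "\<forall>ij\<in>?S - ?S \<inter> {(p, q)}. ?f ij = 0"
      using zero by blast
  qed auto
  also have "\<dots> = (if length Xs = p + q then ?f (p, q) else 0)"
    by auto
  finally show ?thesis by simp
qed

end


section \<open>Exponentiating the bracket with a square-zero endomorphism\<close>

definition ad :: "('g::ab_group_add \<Rightarrow> 'g) \<Rightarrow> ('g \<Rightarrow> 'g \<Rightarrow> 'g \<Rightarrow> 'g) \<Rightarrow> 'g \<Rightarrow> 'g \<Rightarrow> 'g \<Rightarrow> 'g" where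
  "ad N \<theta> a b c = \<theta> (N a) b c + \<theta> a (N b) c + \<theta> a b (N c) - N (\<theta> a b c)"

text \<open>
  For trilinear \<open>\<theta>\<close> this is the coefficient of \<open>t ^ i\<close> in \<open>\<theta> ((1+tN)a) ((1+tN)b) ((1+tN)c)\<close>.
\<close>

definition insertions ::
  "('g::ab_group_add \<Rightarrow> 'g) \<Rightarrow> ('g \<Rightarrow> 'g \<Rightarrow> 'g \<Rightarrow> 'g) \<Rightarrow> nat \<Rightarrow> 'g \<Rightarrow> 'g \<Rightarrow> 'g \<Rightarrow> 'g" where
  "insertions N \<theta> i a b c =
     (if i = 0 then \<theta> a b c
      else if i = 1 then \<theta> (N a) b c + \<theta> a (N b) c + \<theta> a b (N c)
      else if i = 2 then \<theta> (N a) (N b) c + \<theta> (N a) b (N c) + \<theta> a (N b) (N c)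
      else if i = 3 then \<theta> (N a) (N b) (N c)
      else 0)"

definition ad_term ::
  "('g::ab_group_add \<Rightarrow> 'g) \<Rightarrow> ('g \<Rightarrow> 'g \<Rightarrow> 'g \<Rightarrow> 'g) \<Rightarrow> nat \<Rightarrow> 'g \<Rightarrow> 'g \<Rightarrow> 'g \<Rightarrow> 'g" where
  "ad_term N \<theta> i a b c =
     insertions N \<theta> i a b c - (if i = 0 then 0 else N (insertions N \<theta> (i - 1) a b c))"

locale square_zero_endomorphism = vector_space scale
  for scale :: "'k::field_char_0 \<Rightarrow> 'g::ab_group_add \<Rightarrow> 'g" +
  fixes N :: "'g \<Rightarrow> 'g"
  assumes linear_N: "Vector_Spaces.linear scale scale N"
    and square_zero: "N (N a) = 0"
begin

sublocale N: Vector_Spaces.linear scale scale N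
  by (rule linear_N)

lemmas N_simps = N.add N.diff N.scale N.zero N.neg square_zero

lemma gbracket_cochain1:
  assumes "zero_absorbing \<theta>"
  shows "gbracket scale (cochain1 \<theta>) (cochain0 UNIV N) = cochain1 (ad N \<theta>)"
proof (intro ext)
  fix Xs x
  show "gbracket scale (cochain1 \<theta>) (cochain0 UNIV N) Xs x = cochain1 (ad N \<theta>) Xs x"
  proof (cases "length Xs = 1")
    case True
    then obtain a b where Xs: "Xs = [(a, b)]"
      by (cases Xs) auto
    show ?thesis
      unfolding gbracket_homogeneous[OF homogeneous_cochain1[OF assms] homogeneous_cochain0[of N, OF N.zero]]
      by (simp add: Xs circ_def Let_def shuffle_perms_trivial cochain1_def cochain0_def ad_def
          sign_id scale_one)
  next
    case False
    then show ?thesis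
      unfolding gbracket_homogeneous[OF homogeneous_cochain1[OF assms] homogeneous_cochain0[of N, OF N.zero]]
      by (auto simp: cochain1_def split: list.splits)
  qed
qed

lemma zero_absorbing_ad: "zero_absorbing \<theta> \<Longrightarrow> zero_absorbing (ad N \<theta>)"
  by (simp add: zero_absorbing_def ad_def N_simps)

lemma gbracket_power:
  assumes "zero_absorbing \<theta>"
  shows "((\<lambda>P. gbracket scale P (cochain0 UNIV N)) ^^ i) (cochain1 \<theta>) = cochain1 ((ad N ^^ i) \<theta>)"
proof -
  have "zero_absorbing ((ad N ^^ i) \<theta>)" for i
    by (induction i) (auto intro: assms zero_absorbing_ad)
  then show ?thesis
    by (induction i) (auto simp: gbracket_cochain1)
qed

lemma ad_scale: "ad N (\<lambda>a b c. scale r (\<theta> a b c)) = (\<lambda>a b c. scale r (ad N \<theta> a b c))"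
  by (intro ext) (simp add: ad_def N_simps scale_right_distrib scale_right_diff_distrib)

text \<open>
  A second insertion into an argument that already carries \<open>N\<close> vanishes, so each choice of
  \<open>i + 1\<close> arguments is reached from exactly \<open>i + 1\<close> choices of \<open>i\<close> arguments.
\<close>

lemma insertions_Suc:
  assumes "zero_absorbing \<theta>"
  shows "insertions N \<theta> i (N a) b c + insertions N \<theta> i a (N b) c + insertions N \<theta> i a b (N c) =
    scale (of_nat (Suc i)) (insertions N \<theta> (Suc i) a b c)"
proof -
  consider "i = 0" | "i = 1" | "i = 2" | "i = 3" | "i > 3"
    by linarith
  then show ?thesis
  proof cases
    case 2
    have "scale (2::'k) z = z + z" for z
      using scale_left_distrib[of 1 1 z] by simp
    then show ?thesis
      using 2 by (simp add: insertions_def square_zero zero_absorbingD[OF assms])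
  next
    case 3
    have "scale (3::'k) z = z + z + z" for z
      using scale_left_distrib[of 2 1 z] scale_left_distrib[of 1 1 z] by simp
    then show ?thesis
      using 3 by (simp add: insertions_def square_zero zero_absorbingD[OF assms])
  qed (auto simp: insertions_def square_zero zero_absorbingD[OF assms])
qed

text \<open>
  Inserting \<open>N\<close> once more multiplies the two parts of \<open>ad_term N \<theta> i\<close> by \<open>i + 1\<close> and \<open>i\<close>. The summand
  of \<open>ad\<close> that applies \<open>N\<close> to the result annihilates the second part and contributes the missing
  copy of \<open>N (insertions N \<theta> i a b c)\<close> through the first.
\<close>

lemma ad_ad_term:
  assumes "zero_absorbing \<theta>"
  shows "ad N (ad_term N \<theta> i) a b c = scale (of_nat (Suc i)) (ad_term N \<theta> (Suc i) a b c)"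
proof (cases i)
  case 0
  then show ?thesis
    by (simp add: ad_def ad_term_def insertions_def)
next
  case (Suc j)
  let ?e = "insertions N \<theta>"
  have N_sum: "N (?e j (N a) b c) + N (?e j a (N b) c) + N (?e j a b (N c)) =
      scale (of_nat i) (N (?e i a b c))"
    using arg_cong[OF insertions_Suc[OF assms, of j a b c], of N] by (simp only: N_simps Suc)
  have "ad N (ad_term N \<theta> i) a b c =
      (?e i (N a) b c + ?e i a (N b) c + ?e i a b (N c))
      - (N (?e j (N a) b c) + N (?e j a (N b) c) + N (?e j a b (N c))) - N (?e i a b c)"
    by (simp add: ad_def ad_term_def Suc N_simps algebra_simps)
  also have "\<dots> = scale (of_nat (Suc i)) (?e (Suc i) a b c)
      - scale (of_nat i) (N (?e i a b c)) - N (?e i a b c)"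
    unfolding insertions_Suc[OF assms] N_sum ..
  also have "\<dots> = scale (of_nat (Suc i)) (ad_term N \<theta> (Suc i) a b c)"
    by (simp add: ad_term_def scale_right_diff_distrib scale_left_distrib algebra_simps)
  finally show ?thesis .
qed

lemma ad_power:
  assumes "zero_absorbing \<theta>"
  shows "(ad N ^^ i) \<theta> = (\<lambda>a b c. scale (fact i) (ad_term N \<theta> i a b c))"
proof (induction i)
  case 0
  show ?case by (simp add: ad_term_def insertions_def fun_eq_iff)
next
  case (Suc i)
  have "(ad N ^^ Suc i) \<theta> = ad N (\<lambda>a b c. scale (fact i) (ad_term N \<theta> i a b c))"
    using Suc by simp
  also have "\<dots> = (\<lambda>a b c. scale (fact (Suc i)) (ad_term N \<theta> (Suc i) a b c))"
    unfolding ad_scale ad_ad_term[OF assms] by (simp add: mult.commute del: of_nat_Suc)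
  finally show ?case .
qed

lemma ad_power_divided:
  assumes "zero_absorbing \<theta>"
  shows "scale (1 / fact i) (cochain1 ((ad N ^^ i) \<theta>) Xs c) = cochain1 (ad_term N \<theta> i) Xs c"
  by (auto simp: ad_power[OF assms] cochain1_def split: list.splits)

text \<open>
  Insertions stop at three, the number of arguments, but they still contribute
  \<open>- N (insertions N \<theta> 3 a b c)\<close> to the fourth term.
\<close>

lemma twist_eq_sum:
  assumes "zero_absorbing \<theta>"
  shows "twist scale \<theta> (cochain0 UNIV N) a b c = (\<Sum>i\<le>4. ad_term N \<theta> i a b c)"
proof -
  have "twist scale \<theta> (cochain0 UNIV N) a b c = Sum_any (\<lambda>i. ad_term N \<theta> i a b c)"
    by (simp add: twist_def gbracket_power[OF assms] ad_power_divided[OF assms])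
      (simp add: cochain1_def)
  also have "\<dots> = (\<Sum>i\<le>4. ad_term N \<theta> i a b c)"
  proof (rule Sum_any.expand_superset)
    have "ad_term N \<theta> i a b c = 0" if "\<not> i \<le> 4" for i
      using that by (cases i) (auto simp: ad_term_def insertions_def N.zero)
    then show "{i. ad_term N \<theta> i a b c \<noteq> 0} \<subseteq> {..4}"
      by auto
  qed simp
  finally show ?thesis .
qed

end

context three_Lie_algebra
begin

lemmas br_module_hom =
  linear_1[THEN Vector_Spaces.linear.axioms(3)]
  linear_2[THEN Vector_Spaces.linear.axioms(3)]
  linear_3[THEN Vector_Spaces.linear.axioms(3)]

lemmas br_add = br_module_hom[THEN module_hom.add]

lemmas br_scale = br_module_hom[THEN module_hom.scale]

lemma zero_absorbing_br: "zero_absorbing br"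
  by (simp add: zero_absorbing_def br_module_hom[THEN module_hom.zero])

end

text \<open>The exponential of a derivation acts by transport along the exponential of \<open>N\<close>.\<close>

lemma twist_conjugation:
  fixes scale :: "'k::field_char_0 \<Rightarrow> 'g::ab_group_add \<Rightarrow> 'g"
  assumes "three_Lie_algebra scale \<Omega>" and "square_zero_endomorphism scale N"
  shows "twist scale \<Omega> (cochain0 UNIV N) a b c =
    \<Omega> (a + N a) (b + N b) (c + N c) - N (\<Omega> (a + N a) (b + N b) (c + N c))"
proof -
  interpret three_Lie_algebra scale \<Omega> by fact
  interpret square_zero_endomorphism scale N by fact
  let ?e = "\<lambda>i. insertions N \<Omega> i a b c"
  have "\<Omega> (a + N a) (b + N b) (c + N c) = ?e 0 + ?e 1 + ?e 2 + ?e 3"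
    by (simp add: insertions_def br_add add_ac)
  moreover have "(\<Sum>i\<le>4. ad_term N \<Omega> i a b c) =
      ?e 0 + (?e 1 - N (?e 0)) + (?e 2 - N (?e 1)) + (?e 3 - N (?e 2)) - N (?e 3)"
  proof -
    have "{..4} = {0, 1, 2, 3, 4::nat}"
      by auto
    moreover have "?e 4 = 0"
      by (simp add: insertions_def)
    ultimately show ?thesis
      by (simp add: ad_term_def add.assoc)
  qed
  ultimately show ?thesis
    by (simp add: twist_eq_sum[OF zero_absorbing_br] N.add algebra_simps)
qed

text \<open>
  Transport of structure: in a nested bracket the inner \<open>g\<close> meets the outer \<open>f\<close> and cancels, which
  leaves \<open>g\<close> applied to the nested bracket of \<open>\<Omega>\<close>.
\<close>

lemma three_Lie_algebra_conjugate:
  assumes "three_Lie_algebra scale \<Omega>"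
    and f: "Vector_Spaces.linear scale scale f" and g: "Vector_Spaces.linear scale scale g"
    and fg: "\<And>a. f (g a) = a"
  shows "three_Lie_algebra scale (\<lambda>a b c. g (\<Omega> (f a) (f b) (f c)))"
proof -
  interpret three_Lie_algebra scale \<Omega> by fact
  interpret f: Vector_Spaces.linear scale scale f by fact
  interpret g: Vector_Spaces.linear scale scale g by fact
  show ?thesis
  proof
    fix x y z
    show "g (\<Omega> (f y) (f x) (f z)) = - g (\<Omega> (f x) (f y) (f z))"
      by (subst skew_12) (rule g.neg)
    show "g (\<Omega> (f x) (f z) (f y)) = - g (\<Omega> (f x) (f y) (f z))"
      by (subst skew_23) (rule g.neg)
  next
    fix x1 x2 x3 x4 x5
    show "g (\<Omega> (f x1) (f x2) (f (g (\<Omega> (f x3) (f x4) (f x5))))) =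
      g (\<Omega> (f (g (\<Omega> (f x1) (f x2) (f x3)))) (f x4) (f x5)) +
      g (\<Omega> (f x3) (f (g (\<Omega> (f x1) (f x2) (f x4)))) (f x5)) +
      g (\<Omega> (f x3) (f x4) (f (g (\<Omega> (f x1) (f x2) (f x5)))))"
      unfolding fg by (subst fundamental_identity) (simp only: g.add)
  qed (simp_all add: f.add f.scale g.add g.scale br_add br_scale)
qed


section \<open>The twisting of a twilled 3-Lie algebra by a linear map\<close>

lemma proj_eqI:
  assumes "module.subspace scale V" "module.subspace scale W" "module scale"
    and "V \<inter> W = {0}" "x \<in> V" "u \<in> W" "a = x + u"
  shows "proj V W a = x"
  unfolding proj_def
proof (rule the_equality)
  show "x \<in> V \<and> (\<exists>u\<in>W. a = x + u)"
    using assms by blast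
next
  interpret module scale by fact
  fix x' assume "x' \<in> V \<and> (\<exists>u\<in>W. a = x' + u)"
  then obtain u' where x': "x' \<in> V" and u': "u' \<in> W" and "a = x' + u'"
    by blast
  then have eq: "x' - x = u - u'"
    using assms(7) by (simp add: algebra_simps)
  have "x' - x \<in> V" "u - u' \<in> W"
    using assms(1,2,5,6) x' u' by (auto intro: subspace_diff)
  then have "x' - x \<in> V \<inter> W"
    by (simp add: eq)
  then show "x' = x"
    using assms(4) by simp
qed

locale twilled_with_map = twilled_three_Lie_algebra scale \<Omega> g1 g2
  for scale :: "'k::field_char_0 \<Rightarrow> 'g::ab_group_add \<Rightarrow> 'g" and \<Omega> g1 g2 +
  fixes H :: "'g \<Rightarrow> 'g"
  assumes linear_H: "linear_on scale g2 g1 H"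
begin

abbreviation "p1 \<equiv> proj g1 g2"
abbreviation "p2 \<equiv> proj g2 g1"

definition N :: "'g \<Rightarrow> 'g" where
  "N a = H (p2 a)"

lemma p_eqI:
  assumes "x \<in> g1" "u \<in> g2" "a = x + u"
  shows "p1 a = x" "p2 a = u"
  using proj_eqI[OF subspace_1 subspace_2 module_axioms Int_zero assms]
    proj_eqI[OF subspace_2 subspace_1 module_axioms _ assms(2,1), of a] Int_zero assms(3)
  by (auto simp: Int_commute add.commute)

lemma p_decomp: "p1 a \<in> g1" "p2 a \<in> g2" "p1 a + p2 a = a"
proof -
  obtain x u where *: "x \<in> g1" "u \<in> g2" "a = x + u"
    using sum_UNIV by blast
  then show "p1 a \<in> g1" "p2 a \<in> g2" "p1 a + p2 a = a"
    using p_eqI[OF *] by auto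
qed

lemma p_g1: "x \<in> g1 \<Longrightarrow> p1 x = x" "x \<in> g1 \<Longrightarrow> p2 x = 0"
  using p_eqI[of x 0] subspace_0[OF subspace_2] by auto

lemma p_g2: "u \<in> g2 \<Longrightarrow> p1 u = 0" "u \<in> g2 \<Longrightarrow> p2 u = u"
  using p_eqI[of 0 u] subspace_0[OF subspace_1] by auto

lemma p_add: "p1 (a + b) = p1 a + p1 b" "p2 (a + b) = p2 a + p2 b"
proof -
  have "a + b = (p1 a + p1 b) + (p2 a + p2 b)"
    using p_decomp(3)[of a] p_decomp(3)[of b] by (metis add.assoc add.left_commute)
  then show "p1 (a + b) = p1 a + p1 b" "p2 (a + b) = p2 a + p2 b"
    using p_eqI subspace_add[OF subspace_1] subspace_add[OF subspace_2] p_decomp(1,2) by auto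
qed

lemma p_scale: "p1 (scale r a) = scale r (p1 a)" "p2 (scale r a) = scale r (p2 a)"
proof -
  have "scale r a = scale r (p1 a) + scale r (p2 a)"
    using p_decomp(3)[of a] by (metis scale_right_distrib)
  then show "p1 (scale r a) = scale r (p1 a)" "p2 (scale r a) = scale r (p2 a)"
    using p_eqI subspace_scale[OF subspace_1] subspace_scale[OF subspace_2] p_decomp(1,2) by auto
qed

lemma p_zero: "p1 0 = 0" "p2 0 = 0"
  using p_g1[OF subspace_0[OF subspace_1]] by auto

lemma p_diff: "p1 (a - b) = p1 a - p1 b" "p2 (a - b) = p2 a - p2 b"
  using p_add[of "a - b" b] by (auto simp: algebra_simps)

lemma N_in_g1: "N a \<in> g1"
  using linear_H p_decomp by (auto simp: N_def linear_on_def)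

lemma p_N: "p1 (N a) = N a" "p2 (N a) = 0"
  using p_g1[OF N_in_g1] by auto

sublocale square_zero_endomorphism scale N
proof
  fix a b r
  show "N (a + b) = N a + N b" "N (scale r a) = scale r (N a)"
    using linear_H p_decomp by (auto simp: N_def linear_on_def p_add p_scale)
  have "H (0 + 0) = H 0 + H 0"
    using linear_H subspace_0[OF subspace_2] unfolding linear_on_def by blast
  then have "H 0 = 0"
    by simp
  then show "N (N a) = 0"
    using p_N by (simp add: N_def[of "N a"])
qed

lemma N_p: "N (p1 a) = 0" "N (p2 a) = N a"
  using N.zero by (auto simp: N_def p_g1 p_g2 p_decomp p_zero)

lemma N_g1: "a \<in> g1 \<Longrightarrow> N a = 0"
  using N_p(1)[of a] p_g1 by simp

lemma lift_cochain0: "lift g1 g2 (cochain0 g2 H) = cochain0 UNIV N"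
  by (auto simp: lift_def cochain0_def N_def p_decomp fun_eq_iff)

lemma cochain0_in_cochains: "cochain0 g2 H \<in> cochains scale g2 g1 0"
  using linear_H subspace_add[OF subspace_2] subspace_scale[OF subspace_2]
  by (auto simp: cochains_def cochain0_def linear_on_def)

lemma zero_absorbing_hat:
  "zero_absorbing (mu1_hat \<Omega> g1 g2)" "zero_absorbing (psi_hat \<Omega> g1 g2)"
  "zero_absorbing (mu2_hat \<Omega> g1 g2)"
  by (simp_all add: zero_absorbing_def mu1_hat_def psi_hat_def mu2_hat_def Let_def p_zero
      zero_absorbingD[OF zero_absorbing_br])

abbreviation "\<Omega>H \<equiv> twist scale \<Omega> (lift g1 g2 (cochain0 g2 H))"

lemma \<Omega>H_eq:
  "\<Omega>H a b c = \<Omega> (a + N a) (b + N b) (c + N c) - N (\<Omega> (a + N a) (b + N b) (c + N c))"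
  unfolding lift_cochain0
  by (rule twist_conjugation) unfold_locales

lemma three_Lie_\<Omega>H: "three_Lie_algebra scale \<Omega>H"
proof -
  have f: "Vector_Spaces.linear scale scale (\<lambda>x. x + N x)"
    by unfold_locales (simp_all only: N.add N.scale scale_right_distrib add_ac)
  have g: "Vector_Spaces.linear scale scale (\<lambda>x. x - N x)"
    by unfold_locales (simp_all add: N.add N.scale scale_right_diff_distrib)
  have "(a - N a) + N (a - N a) = a" for a
    by (simp add: N_simps)
  from three_Lie_algebra_conjugate[OF three_Lie_algebra_axioms f g this]
  show ?thesis
    unfolding \<Omega>H_eq[abs_def] .
qed

lemma \<Omega>H_g1: "\<lbrakk>x \<in> g1; y \<in> g1; z \<in> g1\<rbrakk> \<Longrightarrow> \<Omega>H x y z \<in> g1"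
  unfolding \<Omega>H_eq using closed_1[of x y z] N_g1 by simp

text \<open>
  Letting \<open>a\<close>, \<open>b\<close>, \<open>c\<close> range over the whole space and projecting them to \<open>g2\<close> matches the lifted
  cochains in the Maurer-Cartan equation.
\<close>

lemma twilled_\<Omega>H_iff:
  "twilled_three_Lie_algebra scale \<Omega>H g1 g2 \<longleftrightarrow> (\<forall>a b c. p1 (\<Omega>H (p2 a) (p2 b) (p2 c)) = 0)"
proof
  assume "twilled_three_Lie_algebra scale \<Omega>H g1 g2"
  from twilled_three_Lie_algebra.closed_2[OF this]
  show "\<forall>a b c. p1 (\<Omega>H (p2 a) (p2 b) (p2 c)) = 0"
    using p_g2(1) p_decomp(2) by simp
next
  assume *: "\<forall>a b c. p1 (\<Omega>H (p2 a) (p2 b) (p2 c)) = 0"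
  interpret \<Omega>H: three_Lie_algebra scale \<Omega>H by (rule three_Lie_\<Omega>H)
  show "twilled_three_Lie_algebra scale \<Omega>H g1 g2"
  proof
    fix u v w assume "u \<in> g2" "v \<in> g2" "w \<in> g2"
    then have "p1 (\<Omega>H u v w) = 0"
      using *[rule_format, of u v w] by (simp only: p_g2)
    then show "\<Omega>H u v w \<in> g2"
      using p_decomp(2,3)[of "\<Omega>H u v w"] by simp
  qed (rule subspace_1 subspace_2 sum_UNIV Int_zero \<Omega>H_g1; assumption)+
qed

text \<open>
  An argument carrying \<open>N\<close> is in \<open>g1\<close>, so on each side only the components with the right number
  of arguments from \<open>g1\<close> survive. The terms \<open>p1 (\<Omega> u v w)\<close> and \<open>N (\<Omega> (N u) (N v) (N w))\<close>, which
  have no counterpart among the three summands, vanish because \<open>g2\<close> and \<open>g1\<close> are closed.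
\<close>

lemma Maurer_Cartan_expression:
  "ad_term N (mu2_hat \<Omega> g1 g2) 1 a b c + ad_term N (psi_hat \<Omega> g1 g2) 2 a b c
     + ad_term N (mu1_hat \<Omega> g1 g2) 3 a b c = p1 (\<Omega>H (p2 a) (p2 b) (p2 c))"
proof -
  let ?e = "\<lambda>i. insertions N \<Omega> i (p2 a) (p2 b) (p2 c)"
  let ?Z = "\<Omega> (p2 a + N (p2 a)) (p2 b + N (p2 b)) (p2 c + N (p2 c))"
  note hat = insertions_def mu2_hat_def psi_hat_def mu1_hat_def Let_def p_N p_zero
    zero_absorbingD[OF zero_absorbing_br] N_p N.add p_add
  have closed: "p1 (?e 0) = 0" "N (?e 3) = 0"
    using p_g2(1)[OF closed_2] N_g1[OF closed_1] p_decomp(2) N_in_g1 by (auto simp: insertions_def)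
  have Z: "?Z = ?e 0 + ?e 1 + ?e 2 + ?e 3"
    by (simp add: insertions_def br_add add_ac)
  have h1: "ad_term N (mu2_hat \<Omega> g1 g2) 1 a b c = p1 (?e 1) - N (?e 0)"
    by (simp add: ad_term_def hat add_ac)
  have h2: "ad_term N (psi_hat \<Omega> g1 g2) 2 a b c = p1 (?e 2) - N (?e 1)"
    by (simp add: ad_term_def hat add_ac)
  have h3: "ad_term N (mu1_hat \<Omega> g1 g2) 3 a b c = p1 (?e 3) - N (?e 2)"
    by (simp add: ad_term_def hat add_ac)
  have h4: "p1 (\<Omega>H (p2 a) (p2 b) (p2 c)) = p1 ?Z - N ?Z"
    unfolding \<Omega>H_eq p_diff p_N ..
  show ?thesis
    unfolding h1 h2 h3 h4 Z p_add N.add closed by (simp only: algebra_simps)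
qed

lemma Maurer_Cartan_iff:
  "Maurer_Cartan scale (Linf_space scale g1 g2) (Linf_op scale \<Omega> g1 g2) (lift g1 g2 (cochain0 g2 H))
     \<longleftrightarrow> (\<forall>a b c. p1 (\<Omega>H (p2 a) (p2 b) (p2 c)) = 0)"
proof -
  let ?A = "cochain0 UNIV N"
  let ?l = "\<lambda>k Xs x. if k \<ge> 1 then scale (1 / fact k)
    (Linf_op scale \<Omega> g1 g2 (replicate k ?A) Xs x) else 0"
  let ?\<theta> = "\<lambda>k::nat. if k = 1 then mu2_hat \<Omega> g1 g2 else if k = 2 then psi_hat \<Omega> g1 g2
    else mu1_hat \<Omega> g1 g2"
  have abs: "zero_absorbing (?\<theta> k)" for k
    by (simp add: zero_absorbing_hat)
  have op: "Linf_op scale \<Omega> g1 g2 (replicate k ?A) =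
      ((\<lambda>P. gbracket scale P ?A) ^^ k) (cochain1 (?\<theta> k))" if "k \<in> {1, 2, 3}" for k
    using that by (auto simp: Linf_op_def eval_nat_numeral)
  have l: "?l k Xs x = cochain1 (ad_term N (?\<theta> k) k) Xs x" if "k \<in> {1, 2, 3}" for k Xs x
  proof -
    have "?l k Xs x = scale (1 / fact k) (Linf_op scale \<Omega> g1 g2 (replicate k ?A) Xs x)"
      using that by auto
    then show ?thesis
      unfolding op[OF that] gbracket_power[OF abs] ad_power_divided[OF abs] .
  qed
  have l_zero: "?l k Xs x = 0" if k: "k \<notin> {1, 2, 3}" for k Xs x
  proof -
    have "k = 0 \<or> (\<exists>j. k = Suc (Suc (Suc (Suc j))))"
      using k by simp presburger
    then show ?thesis
      by (auto simp: Linf_op_def)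
  qed
  have sum: "Sum_any (\<lambda>k. ?l k Xs x) = (\<Sum>k\<in>{1, 2, 3}. cochain1 (ad_term N (?\<theta> k) k) Xs x)" for Xs x
  proof -
    have "Sum_any (\<lambda>k. ?l k Xs x) = (\<Sum>k\<in>{1, 2, 3}. ?l k Xs x)"
    proof (rule Sum_any.expand_superset)
      show "{k. ?l k Xs x \<noteq> 0} \<subseteq> {1, 2, 3}"
        using l_zero by (intro subsetI, unfold mem_Collect_eq) (rule ccontr, blast)
    qed simp
    also have "\<dots> = (\<Sum>k\<in>{1, 2, 3}. cochain1 (ad_term N (?\<theta> k) k) Xs x)"
      by (rule sum.cong[OF refl l])
    finally show ?thesis .
  qed
  have expr: "Sum_any (\<lambda>k. ?l k Xs x) =
      cochain1 (\<lambda>a b c. p1 (\<Omega>H (p2 a) (p2 b) (p2 c))) Xs x" for Xs x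
  proof -
    have "(\<Sum>k\<in>{1, 2, 3}. cochain1 (ad_term N (?\<theta> k) k) Xs x) =
        cochain1 (ad_term N (mu2_hat \<Omega> g1 g2) 1) Xs x + cochain1 (ad_term N (psi_hat \<Omega> g1 g2) 2) Xs x
          + cochain1 (ad_term N (mu1_hat \<Omega> g1 g2) 3) Xs x"
      by (simp add: add.assoc)
    also have "\<dots> = cochain1 (\<lambda>a b c. p1 (\<Omega>H (p2 a) (p2 b) (p2 c))) Xs x"
      unfolding Maurer_Cartan_expression[symmetric] cochain1_def
      by (simp split: list.split)
    finally show ?thesis
      unfolding sum .
  qed
  have "?A \<in> Linf_space scale g1 g2 0"
    unfolding Linf_space_def lift_cochain0[symmetric] using cochain0_in_cochains by (rule imageI)
  then have "Maurer_Cartan scale (Linf_space scale g1 g2) (Linf_op scale \<Omega> g1 g2) ?A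
      \<longleftrightarrow> (\<forall>Xs x. cochain1 (\<lambda>a b c. p1 (\<Omega>H (p2 a) (p2 b) (p2 c))) Xs x = 0)"
    unfolding Maurer_Cartan_def expr by simp
  also have "\<dots> \<longleftrightarrow> (\<forall>a b c. p1 (\<Omega>H (p2 a) (p2 b) (p2 c)) = 0)"
  proof (intro iffI allI)
    fix a b c
    assume "\<forall>Xs x. cochain1 (\<lambda>a b c. p1 (\<Omega>H (p2 a) (p2 b) (p2 c))) Xs x = 0"
    from this[rule_format, of "[(a, b)]" c] show "p1 (\<Omega>H (p2 a) (p2 b) (p2 c)) = 0"
      by (simp add: cochain1_def)
  next
    fix Xs x
    assume "\<forall>a b c. p1 (\<Omega>H (p2 a) (p2 b) (p2 c)) = 0"
    then show "cochain1 (\<lambda>a b c. p1 (\<Omega>H (p2 a) (p2 b) (p2 c))) Xs x = 0"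
      unfolding cochain1_def by (simp split: list.split)
  qed
  finally show ?thesis
    by (simp only: lift_cochain0)
qed

end

theorem theorem4p6:
  fixes scale :: "'k::{alg_closed_field, field_char_0} \<Rightarrow> 'g::ab_group_add \<Rightarrow> 'g"
    and Basis :: "'g set"
    and \<Omega> :: "'g \<Rightarrow> 'g \<Rightarrow> 'g \<Rightarrow> 'g"
    and g1 g2 :: "'g set"
    and H :: "'g \<Rightarrow> 'g"
  assumes "finite_dimensional_vector_space scale Basis"
    and "twilled_three_Lie_algebra scale \<Omega> g1 g2"
    and "linear_on scale g2 g1 H"
  shows "twilled_three_Lie_algebra scale (twist scale \<Omega> (lift g1 g2 (cochain0 g2 H))) g1 g2
     \<longleftrightarrow> Maurer_Cartan scale (Linf_space scale g1 g2) (Linf_op scale \<Omega> g1 g2)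
           (lift g1 g2 (cochain0 g2 H))"
proof -
  interpret twilled_with_map scale \<Omega> g1 g2 H
    using assms(2,3) by (intro twilled_with_map.intro twilled_with_map_axioms.intro)
  show ?thesis
    unfolding twilled_\<Omega>H_iff Maurer_Cartan_iff ..
qed

end
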